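(* Let $X\ne\{0\}$ be an $F$-space. If $\mathcal{A}$ is the family of subsets of $\mathbb{Z}_+$ with positive lower Banach density, then $X$ does not support an $\mathcal{A}$-frequently hypercyclic operator; that is, no continuous linear operator $T$ on $X$ is $\mathcal{A}$-frequently hypercyclic.
   Context: $\mathbb{Z}_+$ is the set of non-negative integers. An $F$-space is a topological vector space whose topology is induced by a complete translation-invariant metric. For $A\subseteq\mathbb{Z}_+$, let $\alpha_s=\liminf_{k\to\infty}|A\cap[k+1,k+s]|$; the lower Banach density of $A$ is $\underline{Bd}(A)=\lim_{s\to\infty}\alpha_s/s$ (the limit always exists). For a continuous linear operator $T$ on $X$, $x\in X$ and $V\subset X$, $N(x,V)=\{n\ge0:T^nx\in V\}$. $T$ is $\mathcal{A}$-frequently hypercyclic if there exists $x\in X$ such that $N(x,V)\in\mathcal{A}$ for every non-empty open set $V\subset X$. *)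

theory Defs
  imports "HOL-Analysis.Analysis"
begin

text \<open>Up to isomorphism the scalar fields of class \<^class>\<open>real_normed_field\<close> are exactly the real
  and the complex numbers, so both real and complex spaces are covered. The metric is only required
  to exist: it is not part of the structure. Continuity of addition is provided by the class
  \<^class>\<open>topological_ab_group_add\<close>.\<close>

locale F_space = vector_space scale
  for scale :: "'k::real_normed_field \<Rightarrow> 'a::topological_ab_group_add \<Rightarrow> 'a" +
  assumes continuous_scale: "continuous_on UNIV (\<lambda>(c, x). scale c x)"
    and complete_invariant_metric:
      "\<exists>d. Metric_space UNIV d \<and> Metric_space.mtopology UNIV d = (euclidean :: 'a topology) \<and>
           Metric_space.mcomplete UNIV d \<and> (\<forall>x y z. d (x + z) (y + z) = d x y)"

definition return_set :: "('a \<Rightarrow> 'a) \<Rightarrow> 'a \<Rightarrow> 'a set \<Rightarrow> nat set" where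
  "return_set T x V = {n. (T ^^ n) x \<in> V}"

definition frequently_hypercyclic ::
    "nat set set \<Rightarrow> ('a::topological_space \<Rightarrow> 'a) \<Rightarrow> bool" where
  "frequently_hypercyclic \<A> T \<longleftrightarrow> (\<exists>x. \<forall>V. open V \<and> V \<noteq> {} \<longrightarrow> return_set T x V \<in> \<A>)"

definition window_liminf :: "nat set \<Rightarrow> nat \<Rightarrow> ereal" where
  "window_liminf A s = liminf (\<lambda>k. ereal (real (card (A \<inter> {k+1..k+s}))))"

definition lower_Banach_density :: "nat set \<Rightarrow> ereal" where
  "lower_Banach_density A = lim (\<lambda>s. window_liminf A s / ereal (real s))"

text \<open>The limit in the definition of the density always exists, by superadditivity of
  \<^const>\<open>window_liminf\<close> and Fekete's lemma.\<close>

lemma window_liminf_nonneg: "0 \<le> window_liminf A s"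
  unfolding window_liminf_def by (intro Liminf_bounded) auto

lemma window_liminf_le: "window_liminf A s \<le> ereal (real s)"
proof -
  have "card (A \<inter> {k+1..k+s}) \<le> s" for k
    using card_mono[of "{k+1..k+s}" "A \<inter> {k+1..k+s}"] by auto
  then have "window_liminf A s \<le> liminf (\<lambda>k::nat. ereal (real s))"
    unfolding window_liminf_def by (intro Liminf_mono) auto
  then show ?thesis by (simp add: Liminf_const)
qed

lemma window_liminf_superadditive:
  "window_liminf A s + window_liminf A t \<le> window_liminf A (s + t)"
proof -
  let ?c = "\<lambda>s k. ereal (real (card (A \<inter> {k+1..k+s})))"
  have shift: "liminf (\<lambda>k. ?c t (k + s)) = window_liminf A t"
    unfolding window_liminf_def using liminf_shift_k[of "?c t" s] by simp
  have split: "?c (s + t) k = ?c s k + ?c t (k + s)" for k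
  proof -
    have "A \<inter> {k+1..k+(s+t)} = (A \<inter> {k+1..k+s}) \<union> (A \<inter> {(k+s)+1..(k+s)+t})"
      by auto
    moreover have "card \<dots> = card (A \<inter> {k+1..k+s}) + card (A \<inter> {(k+s)+1..(k+s)+t})"
      by (rule card_Un_disjoint) auto
    ultimately show ?thesis by simp
  qed
  have "window_liminf A s + window_liminf A t = liminf (?c s) + liminf (\<lambda>k. ?c t (k + s))"
    by (simp only: shift window_liminf_def)
  also have "\<dots> \<le> liminf (\<lambda>k. ?c s k + ?c t (k + s))"
  proof (rule ereal_liminf_add_mono)
    show "\<not> ((liminf (?c s) = \<infinity> \<and> liminf (\<lambda>k. ?c t (k + s)) = - \<infinity>) \<or>
        (liminf (?c s) = - \<infinity> \<and> liminf (\<lambda>k. ?c t (k + s)) = \<infinity>))"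
      using window_liminf_nonneg[of A s] window_liminf_nonneg[of A t]
      unfolding shift window_liminf_def[of A s, symmetric] by auto
  qed
  also have "\<dots> = window_liminf A (s + t)"
    unfolding window_liminf_def by (simp only: split)
  finally show ?thesis .
qed

lemma superadditive_quotient_convergent:
  fixes a :: "nat \<Rightarrow> real"
  assumes super: "\<And>m n. a m + a n \<le> a (m + n)"
    and nonneg: "\<And>n. 0 \<le> a n" and le: "\<And>n. a n \<le> real n"
  shows "convergent (\<lambda>n. a n / real n)"
proof -
  define L where "L = (SUP n. a n / real n)"
  have le1: "a n / real n \<le> 1" for n
    using le[of n] by (cases "n = 0") (auto simp: divide_simps)
  have bdd: "bdd_above (range (\<lambda>n. a n / real n))"
    using le1 by (intro bdd_aboveI[of _ 1]) auto
  have upper: "a n / real n \<le> L" for n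
    unfolding L_def using bdd by (intro cSUP_upper) auto
  have mult: "real q * a m \<le> a (q * m)" for q m
  proof (induction q)
    case 0 then show ?case using nonneg by simp
  next
    case (Suc q) then show ?case using super[of m "q * m"] by (simp add: algebra_simps)
  qed
  have "(\<lambda>n. a n / real n) \<longlonglongrightarrow> L"
  proof (rule order_tendstoI)
    fix y assume "y < L"
    then obtain m where m: "y < a m / real m"
      unfolding L_def using less_cSUP_iff[OF _ bdd] by auto
    show "\<forall>\<^sub>F n in sequentially. y < a n / real n"
    proof (cases "m = 0")
      case True
      then have "y < 0" using m by simp
      then show ?thesis
        using nonneg by (intro always_eventually allI) (rule less_le_trans[of y 0], simp_all)
    next
      case False
      have low: "a m / real m - a m / real n \<le> a n / real n" if "n > 0" for n
      proof -
        have "real n / real m - 1 \<le> real (n div m)"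
        proof -
          have "n < (n div m + 1) * m"
            using dividend_less_div_times[of m n] False by (simp add: algebra_simps)
          then have "real n < real ((n div m + 1) * m)"
            by (simp only: of_nat_less_iff)
          then have "real n < (real (n div m) + 1) * real m"
            by (simp only: of_nat_mult of_nat_add of_nat_1)
          then have "real n / real m < real (n div m) + 1"
            using False by (simp add: pos_divide_less_eq)
          then show ?thesis by simp
        qed
        then have "(real n / real m - 1) * a m \<le> real (n div m) * a m"
          using nonneg by (intro mult_right_mono)
        also have "\<dots> \<le> a (n div m * m)" by (rule mult)
        also have "\<dots> \<le> a n"
          using super[of "n div m * m" "n mod m"] nonneg[of "n mod m"] by simp
        finally have "(real n / real m - 1) * a m / real n \<le> a n / real n"
          by (intro divide_right_mono) auto
        moreover have "(real n / real m - 1) * a m / real n = a m / real m - a m / real n"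
          using that False by (simp add: left_diff_distrib diff_divide_distrib)
        ultimately show ?thesis by simp
      qed
      have "(\<lambda>n. a m / real m - a m / real n) \<longlonglongrightarrow> a m / real m - 0"
        by (intro tendsto_diff tendsto_const lim_const_over_n)
      then have "\<forall>\<^sub>F n in sequentially. y < a m / real m - a m / real n"
        using m by (intro order_tendstoD(1)) auto
      then show ?thesis
        using eventually_gt_at_top[of 0]
        by eventually_elim (rule less_le_trans[OF _ low])
    qed
  next
    fix y assume "L < y"
    then show "\<forall>\<^sub>F n in sequentially. a n / real n < y"
      by (intro always_eventually allI) (rule le_less_trans[OF upper])
  qed
  then show ?thesis by (rule convergentI)
qed

lemma lower_Banach_density_limit:
  "(\<lambda>s. window_liminf A s / ereal (real s)) \<longlonglongrightarrow> lower_Banach_density A"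
proof -
  define a where "a s = real_of_ereal (window_liminf A s)" for s
  have a: "window_liminf A s = ereal (a s)" for s
    unfolding a_def using window_liminf_nonneg[of A s] window_liminf_le[of A s]
    by (cases "window_liminf A s") auto
  have "convergent (\<lambda>s. a s / real s)"
  proof (rule superadditive_quotient_convergent)
    show "a m + a n \<le> a (m + n)" for m n
      using window_liminf_superadditive[of A m n] by (simp add: a)
    show "0 \<le> a n" for n
      using window_liminf_nonneg[of A n] by (simp add: a)
    show "a n \<le> real n" for n
      using window_liminf_le[of A n] by (simp add: a)
  qed
  then obtain l where "(\<lambda>s. a s / real s) \<longlonglongrightarrow> l" by (auto simp: convergent_def)
  then have "(\<lambda>s. ereal (a s / real s)) \<longlonglongrightarrow> ereal l" by simp
  moreover have "\<forall>\<^sub>F s in sequentially.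
      ereal (a s / real s) = window_liminf A s / ereal (real s)"
    using eventually_gt_at_top[of 0] by eventually_elim (simp add: a)
  ultimately have lim: "(\<lambda>s. window_liminf A s / ereal (real s)) \<longlonglongrightarrow> ereal l"
    by (rule Lim_transform_eventually)
  show ?thesis
    unfolding lower_Banach_density_def limI[OF lim] by (rule lim)
qed

end

theory Submission
  imports Defs
begin

text \<open>A set of positive lower Banach density has bounded gaps from some point on: all sufficiently
  late windows of a suitable length \<open>s\<close> meet it. By linearity \<open>0\<close> is a fixed
  point of \<open>T\<close>, and long stays near a fixed point are incompatible with bounded gaps. Separate \<open>0\<close>
  from some \<open>y \<noteq> 0\<close> by disjoint open sets \<open>U \<ni> 0\<close> and \<open>V \<ni> y\<close>. By continuity, an
  orbit that comes close enough to \<open>0\<close> stays in \<open>U\<close>, hence outside \<open>V\<close>, for the next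
  \<open>s\<close> steps. If the orbit visits every neighbourhood of \<open>0\<close> at arbitrarily late times,
  this creates arbitrarily late gaps of length at least \<open>s\<close> between its visits to \<open>V\<close>,
  for every \<open>s\<close>. So the return times to \<open>V\<close> and to every neighbourhood of \<open>0\<close> cannot
  all have positive lower Banach density.\<close>

lemma positive_lower_Banach_density_bounded_gaps:
  assumes "lower_Banach_density A > 0"
  obtains s K where "\<And>k. k \<ge> K \<Longrightarrow> A \<inter> {k+1..k+s} \<noteq> {}"
proof -
  have "\<forall>\<^sub>F s in sequentially. 0 < window_liminf A s / ereal (real s)"
    using lower_Banach_density_limit assms by (rule order_tendstoD(1))
  then obtain s where s: "0 < window_liminf A s / ereal (real s)"
    unfolding eventually_sequentially by blast
  have "window_liminf A s \<noteq> 0"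
    using s by auto
  then have "0 < window_liminf A s"
    using window_liminf_nonneg[of A s] by simp
  then have "\<forall>\<^sub>F k in sequentially. 0 < ereal (real (card (A \<inter> {k+1..k+s})))"
    unfolding window_liminf_def by (rule less_LiminfD)
  then obtain K where "\<And>k. k \<ge> K \<Longrightarrow> 0 < card (A \<inter> {k+1..k+s})"
    unfolding eventually_sequentially by auto
  then have "A \<inter> {k+1..k+s} \<noteq> {}" if "k \<ge> K" for k
    using that by fastforce
  then show thesis by (rule that)
qed

text \<open>An orbit starting close enough to a fixed point shadows it for any prescribed finite time.\<close>

lemma fixed_point_finite_time_stability:
  fixes T :: "'a::topological_space \<Rightarrow> 'a"
  assumes cont: "continuous_on UNIV T" and fixed: "T p = p"
    and U: "open U" "p \<in> U"
  obtains W where "open W" "p \<in> W" "\<And>j w. j \<le> s \<Longrightarrow> w \<in> W \<Longrightarrow> (T ^^ j) w \<in> U"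
proof -
  have iter: "continuous_on UNIV (T ^^ j)" for j
  proof (induction j)
    case (Suc j)
    then show ?case
      using continuous_on_compose[OF Suc continuous_on_subset[OF cont]] by simp
  qed (simp add: id_def)
  have fix_iter: "(T ^^ j) p = p" for j
    using fixed by (induction j) auto
  show thesis
  proof
    show "open (\<Inter>j\<in>{..s}. (T ^^ j) -` U)"
      using iter U(1) by (intro open_INT) (auto intro: open_vimage)
    show "p \<in> (\<Inter>j\<in>{..s}. (T ^^ j) -` U)"
      using fix_iter U(2) by simp
  qed auto
qed

text \<open>The gap bound \<open>s\<close> for the visits to \<open>V\<close> is chosen before the neighbourhood \<open>W\<close>
  of \<open>p\<close>, so that one late visit to \<open>W\<close> keeps the orbit out of \<open>V\<close> for \<open>s\<close> steps.\<close>

lemma fixed_point_not_frequently_hypercyclic: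
  fixes T :: "'a::topological_space \<Rightarrow> 'a"
  assumes cont: "continuous_on UNIV T" and fixed: "T p = p"
    and U: "open U" "p \<in> U" and V: "open V" "V \<noteq> {}" and disj: "U \<inter> V = {}"
  shows "\<not> frequently_hypercyclic {A. lower_Banach_density A > 0} T"
proof
  assume "frequently_hypercyclic {A. lower_Banach_density A > 0} T"
  then obtain x where
    x: "\<And>G. open G \<Longrightarrow> G \<noteq> {} \<Longrightarrow> lower_Banach_density (return_set T x G) > 0"
    unfolding frequently_hypercyclic_def by auto
  obtain s K where V_visits: "\<And>k. k \<ge> K \<Longrightarrow> return_set T x V \<inter> {k+1..k+s} \<noteq> {}"
    using positive_lower_Banach_density_bounded_gaps[OF x[OF V]] by blast
  obtain W where W: "open W" "p \<in> W"
    and stay: "\<And>j w. j \<le> s \<Longrightarrow> w \<in> W \<Longrightarrow> (T ^^ j) w \<in> U"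
    using fixed_point_finite_time_stability[OF cont fixed U] by blast
  obtain t L where W_visits: "\<And>k. k \<ge> L \<Longrightarrow> return_set T x W \<inter> {k+1..k+t} \<noteq> {}"
    using positive_lower_Banach_density_bounded_gaps[OF x[OF W(1)]] W(2) by blast
  obtain n where n: "n \<in> return_set T x W" "n \<ge> K"
    using W_visits[of "max K L"] by fastforce
  obtain m where m: "m \<in> return_set T x V" "n + 1 \<le> m" "m \<le> n + s"
    using V_visits[OF n(2)] by auto
  have "(T ^^ m) x = (T ^^ (m - n)) ((T ^^ n) x)"
    using m(2) by (metis add_leD1 comp_apply funpow_add le_add_diff_inverse2)
  also have "\<dots> \<in> U"
    using n(1) m(3) by (intro stay) (auto simp: return_set_def)
  finally show False
    using m(1) disj by (auto simp: return_set_def)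
qed

theorem proposition15:
  fixes scale :: "'k::real_normed_field \<Rightarrow> 'a::topological_ab_group_add \<Rightarrow> 'a"
  assumes "F_space scale"
    and "(UNIV :: 'a set) \<noteq> {0}"
  shows "\<not> (\<exists>T. Vector_Spaces.linear scale scale T \<and> continuous_on UNIV T \<and>
              frequently_hypercyclic {A. lower_Banach_density A > 0} T)"
proof -
  obtain y :: 'a where y: "y \<noteq> 0"
    using assms(2) by auto
  obtain d where d: "Metric_space (UNIV :: 'a set) d"
    "Metric_space.mtopology UNIV d = (euclidean :: 'a topology)"
    using F_space.complete_invariant_metric[OF assms(1)] by blast
  have "Hausdorff_space (euclidean :: 'a topology)"
    using Metric_space.Hausdorff_space_mtopology[OF d(1)] by (simp add: d(2))
  then obtain U V :: "'a set" where UV: "open U" "open V" "0 \<in> U" "y \<in> V" "U \<inter> V = {}"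
    using y unfolding Hausdorff_space_def disjnt_def
    by (metis UNIV_I open_openin topspace_euclidean)
  have "\<not> frequently_hypercyclic {A. lower_Banach_density A > 0} T"
    if "Vector_Spaces.linear scale scale T" "continuous_on UNIV T" for T
  proof (rule fixed_point_not_frequently_hypercyclic)
    interpret Vector_Spaces.linear scale scale T by (rule that(1))
    show "T 0 = 0" by (rule zero)
  qed (use that UV in auto)
  then show ?thesis by blast
qed

end
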